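(* Let $Y$ be a topological space such that $|Y|\geq 2^{\mathfrak c}$. Then the relation $\omega^{*}\rightarrow(Y)^{1}_{2}$ fails; that is, there are sets $P_0,P_1$ with $\omega^{*}=P_0\cup P_1$ such that neither $P_0$ nor $P_1$ contains a subspace homeomorphic to $Y$.
   Context: $\mathfrak c=2^{\aleph_0}$. $\omega$ is the countably infinite discrete space, $\beta(\omega)$ its Stone-Čech compactification, and $\omega^{*}=\beta(\omega)\setminus\omega$ with the subspace topology. For topological spaces $X,Y$, the relation $X\rightarrow(Y)^{1}_{2}$ means: whenever $X=P_0\cup P_1$, there are $i\in\{0,1\}$ and $Y'\subseteq P_i$ such that $Y'$ (with the subspace topology from $X$) is homeomorphic to $Y$. *)

theory Defs
  imports "HOL-Analysis.Analysis"
begin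

definition unit_interval_maps :: "'a topology \<Rightarrow> ('a \<Rightarrow> real) set" where
  "unit_interval_maps X =
     {f \<in> extensional (topspace X). continuous_map X (top_of_set {0..1}) f}"

definition tychonoff_cube :: "'a topology \<Rightarrow> (('a \<Rightarrow> real) \<Rightarrow> real) topology" where
  "tychonoff_cube X = product_topology (\<lambda>_. top_of_set {0..1}) (unit_interval_maps X)"

definition stone_cech_map :: "'a topology \<Rightarrow> 'a \<Rightarrow> (('a \<Rightarrow> real) \<Rightarrow> real)" where
  "stone_cech_map X x = (\<lambda>f\<in>unit_interval_maps X. f x)"

text \<open>The Stone-Cech compactification of a Tychonoff space \<open>X\<close>, constructed as the closure of the
  image of \<open>X\<close> under the evaluation map into the cube indexed by all continuous maps
  from \<open>X\<close> to the unit interval. The facts below record that this is a compact Hausdorff space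
  containing \<open>X\<close> as a dense subspace from which such maps extend continuously.\<close>

definition stone_cech :: "'a topology \<Rightarrow> (('a \<Rightarrow> real) \<Rightarrow> real) topology" where
  "stone_cech X =
     subtopology (tychonoff_cube X) (tychonoff_cube X closure_of (stone_cech_map X ` topspace X))"

abbreviation omega :: "nat topology" where
  "omega \<equiv> discrete_topology UNIV"

definition omega_star :: "((nat \<Rightarrow> real) \<Rightarrow> real) topology" where
  "omega_star =
     subtopology (stone_cech omega)
       (topspace (stone_cech omega) - stone_cech_map omega ` topspace omega)"

text \<open>The partition relation \<open>X \<rightarrow> (Y)\<^sup>1\<^sub>2\<close>.\<close>

definition arrows_1_2 :: "'a topology \<Rightarrow> 'b topology \<Rightarrow> bool" where
  "arrows_1_2 X Y \<longleftrightarrow>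
     (\<forall>P :: nat \<Rightarrow> 'a set. topspace X = P 0 \<union> P 1 \<longrightarrow>
        (\<exists>i\<in>{0, 1}. \<exists>Y' \<subseteq> P i. subtopology X Y' homeomorphic_space Y))"

lemma compact_space_stone_cech: "compact_space (stone_cech X)"
  unfolding stone_cech_def
  by (intro compact_space_subtopology closedin_compact_space)
     (auto simp: tychonoff_cube_def compact_space_product_topology compact_space_subtopology)

lemma Hausdorff_space_stone_cech: "Hausdorff_space (stone_cech X)"
  unfolding stone_cech_def tychonoff_cube_def
  by (intro Hausdorff_space_subtopology)
     (auto simp: Hausdorff_space_product_topology Hausdorff_space_subtopology)

lemma stone_cech_map_in_cube:
  "stone_cech_map X ` topspace X \<subseteq> topspace (tychonoff_cube X)"
proof -
  have "f x \<in> {0..1}" if "x \<in> topspace X" "f \<in> unit_interval_maps X" for f x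
    using that by (auto simp: unit_interval_maps_def continuous_map_in_subtopology Pi_iff)
  then show ?thesis
    by (auto simp: tychonoff_cube_def stone_cech_map_def)
qed

lemma stone_cech_map_subset_topspace:
  "stone_cech_map X ` topspace X \<subseteq> topspace (stone_cech X)"
  using stone_cech_map_in_cube[of X] closure_of_subset[OF stone_cech_map_in_cube[of X]]
  by (simp add: stone_cech_def)

lemma stone_cech_dense:
  "stone_cech X closure_of (stone_cech_map X ` topspace X) = topspace (stone_cech X)"
  using closure_of_subset[OF stone_cech_map_in_cube[of X]]
        closure_of_subset_topspace[of "tychonoff_cube X"]
  by (simp add: stone_cech_def closure_of_subtopology Int_absorb1 Int_absorb2)

lemma embedding_map_stone_cech_map:
  assumes "completely_regular_space X" "Hausdorff_space X"
  shows "embedding_map X (stone_cech X) (stone_cech_map X)"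
proof -
  have "mspace (submetric (cfunspace X euclidean_metric) {f. f \<in> topspace X \<rightarrow> {0..1}})
          = unit_interval_maps X"
    by (auto simp: unit_interval_maps_def continuous_map_in_subtopology
        intro: bounded_subset[OF bounded_closed_interval[of 0 "1::real"]])
  with completely_regular_space_cube_embedding_explicit[OF assms]
  have "embedding_map X (tychonoff_cube X) (stone_cech_map X)"
    by (simp add: tychonoff_cube_def stone_cech_map_def[abs_def])
  then show ?thesis
    using closure_of_subset[OF stone_cech_map_in_cube[of X]]
    by (simp add: stone_cech_def embedding_map_in_subtopology)
qed

lemma stone_cech_extension:
  assumes "continuous_map X (top_of_set {0..1::real}) f"
  obtains g where "continuous_map (stone_cech X) (top_of_set {0..1}) g"
    and "\<And>x. x \<in> topspace X \<Longrightarrow> g (stone_cech_map X x) = f x"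
proof
  let ?f = "restrict f (topspace X)"
  have "continuous_map X (top_of_set {0..1}) ?f"
    using assms by (rule continuous_map_eq) auto
  then have f: "?f \<in> unit_interval_maps X"
    by (simp add: unit_interval_maps_def)
  then show "continuous_map (stone_cech X) (top_of_set {0..1}) (\<lambda>z. z ?f)"
    unfolding stone_cech_def tychonoff_cube_def
    by (intro continuous_map_from_subtopology continuous_map_product_projection)
  show "stone_cech_map X x ?f = f x" if "x \<in> topspace X" for x
    using f that by (simp add: stone_cech_map_def)
qed

end

theory Submission
  imports Defs
begin

text \<open>The remainder \<open>\<omega>\<^sup>*\<close> sits in a cube with \<open>\<cc>\<close> coordinates, so every subspace has a dense subset
  of size at most \<open>\<cc>\<close> and \<open>\<omega>\<^sup>*\<close> has at most \<open>2\<^sup>\<cc>\<close> points. An embedding of \<open>Y\<close> into the Hausdorff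
  space \<open>\<omega>\<^sup>*\<close> is determined by its values on a dense set, so there are at most
  \<open>(2\<^sup>\<cc>)\<^sup>\<cc> = 2\<^sup>\<cc>\<close> copies of \<open>Y\<close>. Each copy has at least \<open>2\<^sup>\<cc>\<close> points, so a transfinite recursion in
  the style of Bernstein picks two points from each copy, all distinct; put the first one into
  \<open>P\<^sub>0\<close> and leave the second one to \<open>P\<^sub>1\<close>.\<close>

section \<open>Splitting a family of large sets\<close>

lemma lepoll_iff_card_of_ordLeq:
  includes cardinal_syntax
  shows "A \<lesssim> B \<longleftrightarrow> |A| \<le>o |B|"
  by (simp add: lepoll_def card_of_ordLeq)

text \<open>Transfinite recursion along the cardinal well-order of \<open>I\<close>: each index has
  fewer than |I| predecessors, so the points already used cannot exhaust \<open>A i\<close>.\<close>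

lemma injective_choice:
  includes cardinal_syntax
  fixes A :: "'i \<Rightarrow> 'a set"
  assumes large: "\<And>i. i \<in> I \<Longrightarrow> I \<lesssim> A i"
  obtains p where "inj_on p I" "\<And>i. i \<in> I \<Longrightarrow> p i \<in> A i"
proof -
  let ?r = "|I|"
  have wf: "wf (?r - Id)"
    using card_of_Well_order[of I] by (simp add: well_order_on_def)
  have tot: "total_on I ?r"
    using card_of_well_order_on[of I] by (simp add: well_order_on_def linear_order_on_def)
  define p where
    "p = wfrec (?r - Id) (\<lambda>f i. SOME x. x \<in> A i - f ` underS ?r i)"
  have p_unfold: "p i = (SOME x. x \<in> A i - p ` underS ?r i)" for i
  proof -
    \<comment> \<open>The recursion consults \<open>p\<close> only at strict predecessors of
      \<open>i\<close>, where \<open>cut\<close> changes nothing.\<close>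
    have "cut p (?r - Id) i ` underS ?r i = p ` underS ?r i"
      by (intro image_cong) (auto simp: cut_def underS_def)
    then show ?thesis
      unfolding p_def by (subst wfrec[OF wf]) simp
  qed
  have p: "p i \<in> A i - p ` underS ?r i" if "i \<in> I" for i
  proof -
    have "|p ` underS ?r i| <o |A i|"
    proof (rule ordLeq_ordLess_trans[OF card_of_image])
      have "|underS ?r i| <o |I|"
        using that by (intro card_of_underS card_of_Card_order) (simp add: Field_card_of)
      also have "|I| \<le>o |A i|"
        using large[OF that] by (simp add: lepoll_iff_card_of_ordLeq)
      finally show "|underS ?r i| <o |A i|" .
    qed
    then have "\<not> A i \<subseteq> p ` underS ?r i"
      using card_of_mono1 not_ordLess_ordLeq by blast
    then have "\<exists>x. x \<in> A i - p ` underS ?r i"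
      by blast
    from someI_ex[OF this] show ?thesis
      by (simp only: p_unfold[of i, symmetric])
  qed
  have "inj_on p I"
  proof (rule inj_onI, rule ccontr)
    fix i j assume ij: "i \<in> I" "j \<in> I" "p i = p j" "i \<noteq> j"
    then have "i \<in> underS ?r j \<or> j \<in> underS ?r i"
      using tot by (auto simp: underS_def total_on_def)
    then show False
      using p[OF ij(1)] p[OF ij(2)] ij(3) by (metis DiffD2 imageI)
  qed
  with p show thesis
    by (intro that[of p]) auto
qed

text \<open>Indexing the choice by \<open>\<F> \<times> UNIV\<close> gives each member two points,
  tagged by a truth value. \<open>B\<close> collects the points tagged \<open>True\<close>;
  injectivity over all tagged pairs keeps the \<open>False\<close> points out of it.\<close>

lemma Bernstein_splitting:
  fixes \<F> :: "'a set set"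
  assumes "\<And>A. A \<in> \<F> \<Longrightarrow> \<F> \<times> (UNIV :: bool set) \<lesssim> A"
  obtains B where "\<And>A. A \<in> \<F> \<Longrightarrow> A \<inter> B \<noteq> {} \<and> A - B \<noteq> {}"
proof -
  obtain p where inj: "inj_on p (\<F> \<times> (UNIV :: bool set))"
    and p: "\<And>i. i \<in> \<F> \<times> (UNIV :: bool set) \<Longrightarrow> p i \<in> fst i"
    using assms by (rule injective_choice[of "\<F> \<times> (UNIV :: bool set)" fst]) auto
  show thesis
  proof (rule that[of "(\<lambda>A. p (A, True)) ` \<F>"])
    fix A assume A: "A \<in> \<F>"
    have "p (A, False) \<notin> (\<lambda>A. p (A, True)) ` \<F>"
      using A inj by (auto dest: inj_onD)
    then show "A \<inter> (\<lambda>A. p (A, True)) ` \<F> \<noteq> {} \<and> A - (\<lambda>A. p (A, True)) ` \<F> \<noteq> {}"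
      using A p[of "(A, True)"] p[of "(A, False)"] by auto
  qed
qed

section \<open>Cardinal arithmetic below \<open>\<cc>\<close> and \<open>2\<^sup>\<cc>\<close>\<close>

lemma lepoll_UNIV_iff_inj: "(UNIV :: 'a set) \<lesssim> (UNIV :: 'b set) \<longleftrightarrow> (\<exists>f :: 'a \<Rightarrow> 'b. inj f)"
  by (simp add: lepoll_def)

lemma sequences_lepoll_nat_sets:
  assumes "(UNIV :: 'a set) \<lesssim> (UNIV :: nat set set)"
  shows "(UNIV :: (nat \<Rightarrow> 'a) set) \<lesssim> (UNIV :: nat set set)"
proof -
  obtain e :: "'a \<Rightarrow> nat set" where e: "inj e"
    using assms by (auto simp: lepoll_UNIV_iff_inj)
  \<comment> \<open>The coded sets are laid side by side as a subset of the plane; its n-th section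
    recovers \<open>e (s n)\<close>.\<close>
  have "inj (\<lambda>s :: nat \<Rightarrow> 'a. prod_encode ` (SIGMA n:UNIV. e (s n)))"
  proof (rule injI, rule ext)
    fix s t :: "nat \<Rightarrow> 'a" and n
    assume "prod_encode ` (SIGMA n:UNIV. e (s n)) = prod_encode ` (SIGMA n:UNIV. e (t n))"
    then have "(SIGMA n:UNIV. e (s n)) = (SIGMA n:UNIV. e (t n))"
      by (simp only: inj_image_eq_iff[OF inj_prod_encode])
    then have "e (s n) = e (t n)"
      by blast
    then show "s n = t n"
      using e by (simp add: inj_eq)
  qed
  then show ?thesis
    by (auto simp: lepoll_UNIV_iff_inj)
qed

lemma Times_lepoll_nat_sets:
  assumes "(UNIV :: 'a set) \<lesssim> (UNIV :: nat set set)" "(UNIV :: 'b set) \<lesssim> (UNIV :: nat set set)"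
  shows "(UNIV :: ('a \<times> 'b) set) \<lesssim> (UNIV :: nat set set)"
proof -
  obtain e :: "'a \<Rightarrow> nat set" and e' :: "'b \<Rightarrow> nat set" where e: "inj e" "inj e'"
    using assms by (auto simp: lepoll_UNIV_iff_inj)
  \<comment> \<open>A pair is a sequence with one code at 0 and the other everywhere else, which
    reduces products to sequences.\<close>
  have "inj (\<lambda>(a, b). \<lambda>n::nat. if n = 0 then e a else e' b)"
  proof (rule injI, clarify)
    fix a c :: 'a and b d :: 'b
    assume eq: "(\<lambda>n::nat. if n = 0 then e a else e' b) = (\<lambda>n. if n = 0 then e c else e' d)"
    show "a = c \<and> b = d"
      using fun_cong[OF eq, of 0] fun_cong[OF eq, of 1] e by (simp add: inj_eq)
  qed
  then have "(UNIV :: ('a \<times> 'b) set) \<lesssim> (UNIV :: (nat \<Rightarrow> nat set) set)"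
    by (auto simp: lepoll_UNIV_iff_inj)
  also have "\<dots> \<lesssim> (UNIV :: nat set set)"
    by (intro sequences_lepoll_nat_sets lepoll_refl)
  finally show ?thesis .
qed

lemma functions_lepoll_nat_set_sets:
  assumes "(UNIV :: 'a set) \<lesssim> (UNIV :: nat set set)" "(UNIV :: 'b set) \<lesssim> (UNIV :: nat set set)"
  shows "(UNIV :: ('a \<Rightarrow> 'b) set) \<lesssim> (UNIV :: nat set set set)"
proof -
  obtain c :: "'a \<times> 'b \<Rightarrow> nat set" where c: "inj c"
    using Times_lepoll_nat_sets[OF assms] by (auto simp: lepoll_UNIV_iff_inj)
  \<comment> \<open>A function is its graph, and \<open>c\<close> turns the graph into a family of
    sets of naturals.\<close>
  have "inj (\<lambda>f :: 'a \<Rightarrow> 'b. c ` {(a, f a) |a. True})"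
  proof (rule injI, rule ext)
    fix f g :: "'a \<Rightarrow> 'b" and a
    assume "c ` {(a, f a) |a. True} = c ` {(a, g a) |a. True}"
    then have "{(a, f a) |a. True} = {(a, g a) |a. True}"
      by (simp only: inj_image_eq_iff[OF c])
    then show "f a = g a"
      by blast
  qed
  then show ?thesis
    by (auto simp: lepoll_UNIV_iff_inj)
qed

lemma nat_set_sets_Times_bool_lepoll:
  "(UNIV :: nat set set set) \<times> (UNIV :: bool set) \<lesssim> (UNIV :: nat set set set)"
proof -
  \<comment> \<open>Shifting by \<open>Suc\<close> removes 0 from every member, so
    \<open>{0}\<close> is free to record the truth value.\<close>
  have "inj (\<lambda>(\<A>, b). (image (image Suc) \<A> \<union> (if b then {{0}} else {})) :: nat set set)"
  proof (rule injI, clarify)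
    fix \<A> \<B> :: "nat set set" and a b :: bool
    assume eq: "image (image Suc) \<A> \<union> (if a then {{0}} else {}) =
                image (image Suc) \<B> \<union> (if b then {{0}} else {})"
    have no0: "{0} \<notin> image (image Suc) \<C>" for \<C>
      by (auto simp: set_eq_iff)
    have "a \<longleftrightarrow> {0} \<in> image (image Suc) \<A> \<union> (if a then {{0}} else {})"
      using no0[of \<A>] by simp
    also have "\<dots> \<longleftrightarrow> b"
      unfolding eq using no0[of \<B>] by simp
    finally have "a = b" .
    moreover have "image (image Suc) \<A> = image (image Suc) \<B>"
      using arg_cong[OF eq, of "\<lambda>\<C>. \<C> - {{0}}"] no0[of \<A>] no0[of \<B>]
      by (simp add: Un_Diff split: if_splits)
    then have "\<A> = \<B>"
      by (subst (asm) inj_image_eq_iff) (auto simp: inj_def inj_image_eq_iff)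
    ultimately show "\<A> = \<B> \<and> a = b" by simp
  qed
  then show ?thesis
    by (auto simp: lepoll_def)
qed

section \<open>Copies of a subspace of a product\<close>

text \<open>A basic box around \<open>x\<close> inside \<open>U\<close> restricts only finitely many
  coordinates; agreeing with \<open>x\<close> there puts a point into the box.\<close>

lemma openin_product_topology_finite_support:
  assumes "openin (product_topology X I) U" "x \<in> U"
  obtains J where "finite J"
    "\<And>y. \<lbrakk>y \<in> topspace (product_topology X I); \<And>j. j \<in> J \<Longrightarrow> y j = x j\<rbrakk> \<Longrightarrow> y \<in> U"
proof -
  obtain V where V: "finite {i \<in> I. V i \<noteq> topspace (X i)}" "x \<in> Pi\<^sub>E I V" "Pi\<^sub>E I V \<subseteq> U"
    using assms unfolding openin_product_topology_alt by blast
  show thesis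
  proof (rule that[OF V(1)])
    fix y assume y: "y \<in> topspace (product_topology X I)"
      and eq: "\<And>j. j \<in> {i \<in> I. V i \<noteq> topspace (X i)} \<Longrightarrow> y j = x j"
    have "y i \<in> V i" if "i \<in> I" for i
      using y eq[of i] V(2) that by (cases "V i = topspace (X i)") (auto simp: PiE_iff)
    with y have "y \<in> Pi\<^sub>E I V"
      by (auto simp: PiE_iff)
    with V(3) show "y \<in> U" by blast
  qed
qed

text \<open>Prescribing the values at countably many coordinates defines sets that need not be open, but
  they form a network of the product, and picking one point from each is enough for density.\<close>

lemma dense_subset_of_product_subspace:
  fixes X :: "'i \<Rightarrow> 'b topology"
  assumes S: "S \<subseteq> topspace (product_topology X I)" "S \<noteq> {}"
  obtains d :: "(nat \<Rightarrow> 'i) \<times> (nat \<Rightarrow> 'b) \<Rightarrow> 'i \<Rightarrow> 'b"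
  where "range d \<subseteq> S" "subtopology (product_topology X I) S closure_of range d = S"
proof -
  let ?P = "product_topology X I"
  \<comment> \<open>A point of \<open>S\<close> with the prescribed values if there is one, and
    otherwise any point of \<open>S\<close>.\<close>
  have "\<exists>y \<in> S. (\<exists>x \<in> S. \<forall>k. x (fst gc k) = snd gc k) \<longrightarrow> (\<forall>k. y (fst gc k) = snd gc k)"
    for gc :: "(nat \<Rightarrow> 'i) \<times> (nat \<Rightarrow> 'b)"
    using S by blast
  then obtain d :: "(nat \<Rightarrow> 'i) \<times> (nat \<Rightarrow> 'b) \<Rightarrow> 'i \<Rightarrow> 'b" where dS: "\<And>gc. d gc \<in> S"
    and d: "\<And>gc x k. \<lbrakk>x \<in> S; \<forall>k. x (fst gc k) = snd gc k\<rbrakk> \<Longrightarrow> d gc (fst gc k) = snd gc k"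
    by metis
  have "x \<in> subtopology ?P S closure_of range d" if x: "x \<in> S" for x
    unfolding in_closure_of
  proof (intro conjI allI impI)
    show "x \<in> topspace (subtopology ?P S)"
      using x S by auto
    fix T assume "x \<in> T \<and> openin (subtopology ?P S) T"
    then obtain U where U: "openin ?P U" "x \<in> U" "T = U \<inter> S"
      by (auto simp: openin_subtopology)
    obtain J where J: "finite J"
      "\<And>y. \<lbrakk>y \<in> topspace ?P; \<And>j. j \<in> J \<Longrightarrow> y j = x j\<rbrakk> \<Longrightarrow> y \<in> U"
      using openin_product_topology_finite_support[OF U(1,2)] by blast
    \<comment> \<open>\<open>undefined\<close> only makes the enumerated set nonempty. It does no
      harm, as \<open>x\<close> itself meets the prescription at every coordinate, even outside
      \<open>I\<close>.\<close>
    define g where "g = from_nat_into (insert undefined J)"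
    have g: "range g = insert undefined J"
      unfolding g_def using J(1) by (intro range_from_nat_into) (auto intro: countable_finite)
    let ?y = "d (g, x \<circ> g)"
    have "?y (g k) = x (g k)" for k
      using d[of x "(g, x \<circ> g)" k] x by simp
    then have "?y j = x j" if "j \<in> J" for j
      using g that by (metis insertI2 rangeE)
    then have "?y \<in> U"
      using J(2) dS S(1) by blast
    then show "\<exists>y. y \<in> range d \<and> y \<in> T"
      using dS U(3) by blast
  qed
  moreover have "subtopology ?P S closure_of range d \<subseteq> S"
    using closure_of_subset_topspace[of "subtopology ?P S"] by fastforce
  ultimately show thesis
    using dS by (intro that[of d]) auto
qed

text \<open>Fix a homeomorphism \<open>h S'\<close> for each copy. Continuous maps into a Hausdorff
  space that agree on a dense set are equal, so \<open>h S' \<circ> d\<close> determines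
  \<open>h S'\<close> on \<open>S\<close> and hence its image \<open>S'\<close>.\<close>

lemma homeomorphic_copies_lepoll:
  fixes X :: "'a topology" and d :: "'k \<Rightarrow> 'a"
  assumes "Hausdorff_space X" and dense: "subtopology X S closure_of range d = S"
  shows "{S'. S' \<subseteq> topspace X \<and> subtopology X S homeomorphic_space subtopology X S'}
    \<lesssim> (UNIV :: ('k \<Rightarrow> 'a) set)" (is "?C \<lesssim> _")
proof -
  have "S \<subseteq> topspace X"
    using closure_of_subset_topspace[of "subtopology X S" "range d"] dense by auto
  have "\<forall>S' \<in> ?C. \<exists>h. homeomorphic_map (subtopology X S) (subtopology X S') h"
    by (auto simp: homeomorphic_space)
  then obtain h where h: "\<And>S'. S' \<in> ?C \<Longrightarrow>
      homeomorphic_map (subtopology X S) (subtopology X S') (h S')"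
    by metis
  have cont: "continuous_map (subtopology X S) X (h S')" if "S' \<in> ?C" for S'
    using homeomorphic_imp_continuous_map[OF h[OF that]]
    by (simp only: continuous_map_in_subtopology)
  have im: "h S' ` S = S'" if "S' \<in> ?C" for S'
    using homeomorphic_imp_surjective_map[OF h[OF that]] that \<open>S \<subseteq> topspace X\<close>
    by (simp add: Int_absorb1)
  have "inj_on (\<lambda>S'. h S' \<circ> d) ?C"
  proof (rule inj_onI)
    fix S1 S2 assume C: "S1 \<in> ?C" "S2 \<in> ?C" and eq: "h S1 \<circ> d = h S2 \<circ> d"
    have "h S1 x = h S2 x" if "x \<in> S" for x
    proof -
      have "x \<in> subtopology X S closure_of range d"
        using dense that by simp
      moreover have "h S1 z = h S2 z" if "z \<in> range d" for z
        using that fun_cong[OF eq] by auto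
      ultimately show ?thesis
        by (rule forall_in_closure_of_eq[OF _ assms(1) cont[OF C(1)] cont[OF C(2)]])
    qed
    then have "h S1 ` S = h S2 ` S"
      by (rule image_cong[OF refl])
    then show "S1 = S2"
      by (simp only: im[OF C(1)] im[OF C(2)])
  qed
  then show ?thesis
    unfolding lepoll_def by blast
qed

section \<open>Copies in \<open>\<omega>\<^sup>*\<close>\<close>

lemma omega_star_as_product_subspace:
  "\<exists>T. omega_star =
    subtopology (product_topology (\<lambda>_. top_of_set {0..1}) (unit_interval_maps omega)) T"
  unfolding omega_star_def stone_cech_def tychonoff_cube_def subtopology_subtopology
  by (rule exI, rule refl)

lemma Hausdorff_space_omega_star: "Hausdorff_space omega_star"
  unfolding omega_star_def by (intro Hausdorff_space_subtopology Hausdorff_space_stone_cech)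

lemma homeomorphic_copies_in_omega_star_lepoll:
  "{S'. S' \<subseteq> topspace omega_star \<and> subtopology omega_star S' homeomorphic_space Y}
     \<lesssim> (UNIV :: nat set set set)" (is "?C \<lesssim> _")
proof (cases "\<exists>S \<in> ?C. S \<noteq> {}")
  case False
  then have "?C \<subseteq> {{}}" by auto
  then show ?thesis
    by (rule lepoll_trans[OF subset_imp_lepoll]) (simp add: lepoll_def)
next
  case True
  \<comment> \<open>A nonempty copy serves as reference: all copies of \<open>Y\<close> are
    homeomorphic to it, so only its dense set is needed.\<close>
  then obtain S where S: "S \<subseteq> topspace omega_star" "S \<noteq> {}"
    and SY: "subtopology omega_star S homeomorphic_space Y"
    by blast
  let ?P = "product_topology (\<lambda>_. top_of_set {0..1::real}) (unit_interval_maps omega)"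
  obtain T where T: "omega_star = subtopology ?P T"
    using omega_star_as_product_subspace by (rule exE)
  have "S \<subseteq> topspace ?P" "S \<subseteq> T"
    using S(1) unfolding T topspace_subtopology by (simp_all only: le_inf_iff)
  obtain d :: "(nat \<Rightarrow> nat \<Rightarrow> real) \<times> (nat \<Rightarrow> real) \<Rightarrow> (nat \<Rightarrow> real) \<Rightarrow> real"
    where "range d \<subseteq> S" and "subtopology ?P S closure_of range d = S"
    by (rule dense_subset_of_product_subspace[OF \<open>S \<subseteq> topspace ?P\<close> S(2)])
  then have dense: "subtopology omega_star S closure_of range d = S"
    by (simp add: T subtopology_subtopology Int_absorb1[OF \<open>S \<subseteq> T\<close>])
  have real: "(UNIV :: real set) \<lesssim> (UNIV :: nat set set)"
    by (rule eqpoll_imp_lepoll[OF eqpoll_sym[OF nat_sets_eqpoll_reals]])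
  have "?C \<subseteq> {S'. S' \<subseteq> topspace omega_star \<and>
      subtopology omega_star S homeomorphic_space subtopology omega_star S'}"
    using homeomorphic_space_trans[OF SY] homeomorphic_space_sym[THEN iffD1] by blast
  then have "?C \<lesssim> (UNIV :: ((nat \<Rightarrow> nat \<Rightarrow> real) \<times> (nat \<Rightarrow> real) \<Rightarrow> (nat \<Rightarrow> real) \<Rightarrow> real) set)"
    by (rule lepoll_trans[OF subset_imp_lepoll
          homeomorphic_copies_lepoll[OF Hausdorff_space_omega_star dense]])
  \<comment> \<open>Uncurrying leaves real functions on a type of size at most the continuum, so no
    separate count of the points of \<open>omega_star\<close> is required.\<close>
  also have "\<dots> \<lesssim>
      (UNIV :: (((nat \<Rightarrow> nat \<Rightarrow> real) \<times> (nat \<Rightarrow> real)) \<times> (nat \<Rightarrow> real) \<Rightarrow> real) set)"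
    unfolding lepoll_UNIV_iff_inj
    by (intro exI[of _ case_prod]) (auto simp: inj_def fun_eq_iff)
  also have "\<dots> \<lesssim> (UNIV :: nat set set set)"
    by (intro functions_lepoll_nat_set_sets Times_lepoll_nat_sets sequences_lepoll_nat_sets real)
  finally show ?thesis .
qed

theorem theorem2p2:
  fixes Y :: "'a topology"
  assumes "Pow (Pow (UNIV :: nat set)) \<lesssim> topspace Y"
  shows "\<not> arrows_1_2 omega_star Y \<and>
    (\<exists>P0 P1. topspace omega_star = P0 \<union> P1 \<and>
       \<not> (\<exists>Y' \<subseteq> P0. subtopology omega_star Y' homeomorphic_space Y) \<and>
       \<not> (\<exists>Y' \<subseteq> P1. subtopology omega_star Y' homeomorphic_space Y))"
proof -
  let ?T = "topspace omega_star"
  define \<F> where "\<F> = {S. S \<subseteq> ?T \<and> subtopology omega_star S homeomorphic_space Y}"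
  have "\<F> \<times> (UNIV :: bool set) \<lesssim> S" if "S \<in> \<F>" for S
  proof -
    have "\<F> \<times> (UNIV :: bool set) \<lesssim> (UNIV :: nat set set set) \<times> (UNIV :: bool set)"
      unfolding \<F>_def
      by (intro times_lepoll_mono homeomorphic_copies_in_omega_star_lepoll lepoll_refl)
    also have "\<dots> \<lesssim> (UNIV :: nat set set set)"
      by (rule nat_set_sets_Times_bool_lepoll)
    also have "\<dots> \<lesssim> topspace Y"
      using assms by simp
    also have "topspace Y \<lesssim> S"
    proof -
      have "Y homeomorphic_space subtopology omega_star S" "S \<subseteq> ?T"
        using that homeomorphic_space_sym[THEN iffD1] unfolding \<F>_def by blast+
      then obtain h where "homeomorphic_map Y (subtopology omega_star S) h"
        unfolding homeomorphic_space by blast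
      then show ?thesis
        using \<open>S \<subseteq> ?T\<close> homeomorphic_imp_injective_map homeomorphic_imp_surjective_map
        unfolding lepoll_def by (metis Int_absorb1 order_refl topspace_subtopology)
    qed
    finally show ?thesis .
  qed
  then obtain B where B: "\<And>S. S \<in> \<F> \<Longrightarrow> S \<inter> B \<noteq> {} \<and> S - B \<noteq> {}"
    using Bernstein_splitting by blast
  \<comment> \<open>Every nonzero index gives the complement of \<open>B\<close>, so the argument
    below covers all \<open>i\<close> at once.\<close>
  define P where "P i = (if i = 0 then ?T \<inter> B else ?T - B)" for i :: nat
  have cover: "?T = P 0 \<union> P 1"
    by (auto simp: P_def)
  have no_copy: "\<not> (\<exists>Y' \<subseteq> P i. subtopology omega_star Y' homeomorphic_space Y)" for i
  proof
    assume "\<exists>Y' \<subseteq> P i. subtopology omega_star Y' homeomorphic_space Y"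
    then obtain Y' where Y': "Y' \<subseteq> P i" "subtopology omega_star Y' homeomorphic_space Y"
      by blast
    \<comment> \<open>A copy inside one piece would be a member of \<open>\<F>\<close> contained in
      \<open>B\<close> or disjoint from it.\<close>
    then have "Y' \<in> \<F>"
      by (auto simp: \<F>_def P_def split: if_splits)
    with B[of Y'] Y'(1) show False
      by (auto simp: P_def split: if_splits)
  qed
  show ?thesis
  proof
    show "\<not> arrows_1_2 omega_star Y"
      using cover no_copy unfolding arrows_1_2_def by blast
    show "\<exists>P0 P1. ?T = P0 \<union> P1 \<and>
       \<not> (\<exists>Y' \<subseteq> P0. subtopology omega_star Y' homeomorphic_space Y) \<and>
       \<not> (\<exists>Y' \<subseteq> P1. subtopology omega_star Y' homeomorphic_space Y)"
      by (intro exI[of _ "P 0"] exI[of _ "P 1"] conjI cover no_copy)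
  qed
qed

end
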